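(* Let $G$ be a group, let $R$ be a $G$-graded commutative ring with nonzero unity, let $\phi: GI(R)\to GI(R)\cup\{\emptyset\}$ be a function, and let $P$ be a graded $\phi$-$r$-ideal of $R$. Suppose that $\phi(P)$ is a graded $r$-ideal of $R$. Assume that $I$ and $J$ are graded ideals of $R$ such that $IJ\subseteq P$, $IJ\nsubseteq\phi(P)$ and $Ann(I)=\{0\}$. If $Ann(I)=Ann(c)$ for some $c\in I\cap h(R)$, then $J\subseteq P$.
   Context: $R=\bigoplus_{g\in G}R_g$ with additive subgroups $R_g$ satisfying $R_gR_h\subseteq R_{gh}$; $h(R)=\bigcup_{g\in G}R_g$ is the set of homogeneous elements. An ideal $P$ is graded if $P=\bigoplus_{g\in G}(P\cap R_g)$, and $GI(R)$ is the set of all graded ideals of $R$. Standing convention: $\phi(P)\subseteq P$ for every graded ideal $P$. For $x\in R$, $Ann(x)=\{a\in R: ax=0\}$; for an ideal $I$, $Ann(I)=\{a\in R: aI=\{0\}\}$. A proper graded ideal $P$ of $R$ is a graded $\phi$-$r$-ideal if whenever $x,y\in h(R)$ satisfy $xy\in P-\phi(P)$ (set difference) and $Ann(x)=\{0\}$, then $y\in P$. A proper graded ideal $P$ of $R$ is a graded $r$-ideal if whenever $x,y\in h(R)$, $xy\in P$ and $Ann(x)=\{0\}$, then $y\in P$. *)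

theory Defs
  imports "HOL-Algebra.Algebra"
begin

text \<open>
  Internal direct sum of additive subgroups: every element of \<open>M\<close> is, in exactly one way, a
  sum of a finitely supported family \<open>f\<close> with \<open>f i \<in> A i\<close>, and all such sums lie in \<open>M\<close>.
  The sum is taken over the support of \<open>f\<close>, since \<^const>\<open>finsum\<close> is only meaningful
  over finite index sets.
\<close>
definition internal_direct_sum ::
  "('a, 'm) ring_scheme \<Rightarrow> 'i set \<Rightarrow> ('i \<Rightarrow> 'a set) \<Rightarrow> 'a set \<Rightarrow> bool"
  where "internal_direct_sum R I A M \<longleftrightarrow>
    (\<forall>i\<in>I. additive_subgroup (A i) R) \<and>
    bij_betw (\<lambda>f. finsum R f {i \<in> I. f i \<noteq> \<zero>\<^bsub>R\<^esub>})
      {f \<in> (\<Pi>\<^sub>E i\<in>I. A i). finite {i \<in> I. f i \<noteq> \<zero>\<^bsub>R\<^esub>}} M"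

locale graded_cring = grp: group G + cring R
  for G :: "('g, 'k) monoid_scheme" and R :: "('a, 'm) ring_scheme" (structure) +
  fixes A :: "'g \<Rightarrow> 'a set"
  assumes direct_sum: "internal_direct_sum R (carrier G) A (carrier R)"
    and component_mult:
      "\<lbrakk>g \<in> carrier G; h \<in> carrier G; x \<in> A g; y \<in> A h\<rbrakk> \<Longrightarrow> x \<otimes> y \<in> A (g \<otimes>\<^bsub>G\<^esub> h)"

definition homogeneous :: "('g, 'k) monoid_scheme \<Rightarrow> ('g \<Rightarrow> 'a set) \<Rightarrow> 'a set"
  where "homogeneous G A = (\<Union>g\<in>carrier G. A g)"

definition graded_ideal ::
  "('g, 'k) monoid_scheme \<Rightarrow> ('a, 'm) ring_scheme \<Rightarrow> ('g \<Rightarrow> 'a set) \<Rightarrow> 'a set \<Rightarrow> bool"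
  where "graded_ideal G R A P \<longleftrightarrow>
    ideal P R \<and> internal_direct_sum R (carrier G) (\<lambda>g. P \<inter> A g) P"

definition graded_ideals ::
  "('g, 'k) monoid_scheme \<Rightarrow> ('a, 'm) ring_scheme \<Rightarrow> ('g \<Rightarrow> 'a set) \<Rightarrow> 'a set set"
  where "graded_ideals G R A = {P. graded_ideal G R A P}"

definition Ann_elem :: "('a, 'm) ring_scheme \<Rightarrow> 'a \<Rightarrow> 'a set"
  where "Ann_elem R x = {a \<in> carrier R. a \<otimes>\<^bsub>R\<^esub> x = \<zero>\<^bsub>R\<^esub>}"

definition Ann_ideal :: "('a, 'm) ring_scheme \<Rightarrow> 'a set \<Rightarrow> 'a set"
  where "Ann_ideal R I = {a \<in> carrier R. a <#\<^bsub>R\<^esub> I = {\<zero>\<^bsub>R\<^esub>}}"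

definition graded_phi_r_ideal ::
  "('g, 'k) monoid_scheme \<Rightarrow> ('a, 'm) ring_scheme \<Rightarrow> ('g \<Rightarrow> 'a set) \<Rightarrow>
    ('a set \<Rightarrow> 'a set) \<Rightarrow> 'a set \<Rightarrow> bool"
  where "graded_phi_r_ideal G R A \<phi> P \<longleftrightarrow>
    graded_ideal G R A P \<and> P \<noteq> carrier R \<and>
    (\<forall>x\<in>homogeneous G A. \<forall>y\<in>homogeneous G A.
      x \<otimes>\<^bsub>R\<^esub> y \<in> P - \<phi> P \<and> Ann_elem R x = {\<zero>\<^bsub>R\<^esub>} \<longrightarrow> y \<in> P)"

definition graded_r_ideal ::
  "('g, 'k) monoid_scheme \<Rightarrow> ('a, 'm) ring_scheme \<Rightarrow> ('g \<Rightarrow> 'a set) \<Rightarrow> 'a set \<Rightarrow> bool"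
  where "graded_r_ideal G R A P \<longleftrightarrow>
    graded_ideal G R A P \<and> P \<noteq> carrier R \<and>
    (\<forall>x\<in>homogeneous G A. \<forall>y\<in>homogeneous G A.
      x \<otimes>\<^bsub>R\<^esub> y \<in> P \<and> Ann_elem R x = {\<zero>\<^bsub>R\<^esub>} \<longrightarrow> y \<in> P)"

end

theory Submission
  imports Defs
begin

text \<open>
  Membership in a graded ideal can be tested on homogeneous elements. For homogeneous \<open>y \<in> J\<close> we
  have \<open>c y \<in> I J \<subseteq> P\<close> with \<open>Ann(c) = {0}\<close>. If \<open>c y \<notin> \<phi>(P)\<close>, the graded
  \<open>\<phi>\<close>-\<open>r\<close>-ideal property yields \<open>y \<in> P\<close>; otherwise the graded \<open>r\<close>-ideal \<open>\<phi>(P)\<close> yields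
  \<open>y \<in> \<phi>(P) \<subseteq> P\<close>.
\<close>

lemma (in ring) finsum_mem_ideal:
  assumes "ideal P R" and "\<And>i. i \<in> S \<Longrightarrow> f i \<in> P"
  shows "finsum R f S \<in> P"
proof -
  interpret P: ideal P R by fact
  show ?thesis
    using assms(2)
  proof (induction S rule: infinite_finite_induct)
    \<comment> \<open>Over an infinite index set \<open>finsum\<close> defaults to zero, which every
      ideal contains.\<close>
    case (infinite S)
    then show ?case by (simp add: P.zero_closed)
  next
    case empty
    then show ?case by (simp add: P.zero_closed)
  next
    case (insert i S)
    then have "f \<in> S \<rightarrow> carrier R" "f i \<in> carrier R"
      by (auto intro: P.a_Hcarr)
    with insert show ?case
      by (simp add: P.a_closed)
  qed
qed

text \<open>As \<open>J\<close> is graded, the homogeneous components of an element of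
  \<open>J\<close> lie in \<open>J\<close> again, hence in \<open>P\<close>, and so does their sum.
  The ideal \<open>P\<close> itself may be ungraded.\<close>

lemma (in graded_cring) graded_ideal_subsetI:
  assumes J: "graded_ideal G R A J" and P: "ideal P R"
    and hom: "J \<inter> homogeneous G A \<subseteq> P"
  shows "J \<subseteq> P"
proof
  fix y assume "y \<in> J"
  \<comment> \<open>Surjectivity of the summation map onto \<open>J\<close> provides the
    decomposition of \<open>y\<close>.\<close>
  with J obtain f where f: "f \<in> (\<Pi>\<^sub>E g\<in>carrier G. J \<inter> A g)"
    and y: "y = finsum R f {g \<in> carrier G. f g \<noteq> \<zero>}"
    unfolding graded_ideal_def internal_direct_sum_def bij_betw_def by blast
  have "f g \<in> P" if "g \<in> carrier G" for g
    using PiE_mem[OF f that] hom that by (auto simp: homogeneous_def)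
  then show "y \<in> P"
    unfolding y by (intro finsum_mem_ideal[OF P]) blast
qed

theorem theorem2p14:
  fixes G :: "('g, 'k) monoid_scheme"
    and R :: "('a, 'm) ring_scheme"
    and A :: "'g \<Rightarrow> 'a set"
    and \<phi> :: "'a set \<Rightarrow> 'a set"
    and P I J :: "'a set"
  assumes "graded_cring G R A"
    and "\<one>\<^bsub>R\<^esub> \<noteq> \<zero>\<^bsub>R\<^esub>"
    and "\<phi> \<in> graded_ideals G R A \<rightarrow> graded_ideals G R A \<union> {{}}"
    and "\<And>Q. Q \<in> graded_ideals G R A \<Longrightarrow> \<phi> Q \<subseteq> Q"
    and "graded_phi_r_ideal G R A \<phi> P"
    and "graded_r_ideal G R A (\<phi> P)"
    and "graded_ideal G R A I"
    and "graded_ideal G R A J"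
    and "I \<cdot>\<^bsub>R\<^esub> J \<subseteq> P"
    and "\<not> I \<cdot>\<^bsub>R\<^esub> J \<subseteq> \<phi> P"
    and "Ann_ideal R I = {\<zero>\<^bsub>R\<^esub>}"
    and "\<exists>c \<in> I \<inter> homogeneous G A. Ann_ideal R I = Ann_elem R c"
  shows "J \<subseteq> P"
proof -
  interpret graded_cring G R A by fact
  have P: "graded_ideal G R A P" "ideal P R"
    using assms(5) by (simp_all add: graded_phi_r_ideal_def graded_ideal_def)
  then have sub: "\<phi> P \<subseteq> P"
    using assms(4) by (simp add: graded_ideals_def)
  \<comment> \<open>Since Ann(c) = Ann(I) = {0}, the element \<open>c\<close> can serve as the left
    factor in both defining conditions, that of \<open>P\<close> and that of
    \<open>\<phi> P\<close>.\<close>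
  obtain c where c: "c \<in> I" "c \<in> homogeneous G A" "Ann_elem R c = {\<zero>\<^bsub>R\<^esub>}"
    using assms(11,12) by auto
  show ?thesis
  proof (rule graded_ideal_subsetI[OF assms(8) P(2)], rule subsetI)
    fix y assume y: "y \<in> J \<inter> homogeneous G A"
    have cy: "c \<otimes>\<^bsub>R\<^esub> y \<in> P"
      using assms(9) c(1) y by (blast intro: ideal_prod.prod)
    show "y \<in> P"
    proof (cases "c \<otimes>\<^bsub>R\<^esub> y \<in> \<phi> P")
      case True
      then show ?thesis
        using assms(6) c y sub unfolding graded_r_ideal_def by blast
    next
      case False
      then show ?thesis
        using assms(5) c y cy unfolding graded_phi_r_ideal_def by blast
    qed
  qed
qed

end
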